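(* Let $f:\mathbb R\to(0,\infty)$ be continuous, $1$-periodic, even and satisfy: (i) $f$ is differentiable on $(0,1)$; (ii) there are constants $C>0$ and $\varepsilon>0$ such that $f(t)\le f(0)-Ct$ for all $0\le t<\varepsilon$. Let $X=\{\mathbf x^0,\mathbf x^1,\dots,\mathbf x^{N-1}\}\subseteq\mathbb T^d$ be a (global or local) minimizer of the energy $E_F$. Then $$x_i^k\ne x_i^\ell$$ for all $i=1,\dots,d$ and all $k,\ell\in\{0,1,\dots,N-1\}$ with $k\ne\ell$.
   Context: $\mathbb T=\mathbb R/\mathbb Z$ is identified with $[0,1)$; points are written $\mathbf x^k=(x_1^k,\dots,x_d^k)\in\mathbb T^d$. Given $f$ and $d$, put $F(t_1,\dots,t_d)=f(t_1)\cdots f(t_d)$; for an $N$-point configuration (multiset) $X=\{\mathbf x^0,\dots,\mathbf x^{N-1}\}\subset\mathbb T^d$ the energy is $$E_F(X)=\sum_{k,\ell=0,\ k\ne\ell}^{N-1}\ \prod_{i=1}^d f(x_i^k-x_i^\ell).$$ A (local) minimizer is a (local) minimum point of $E_F$ viewed as a function of $(\mathbf x^0,\dots,\mathbf x^{N-1})\in(\mathbb T^d)^N$. *)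

theory Defs
  imports "HOL-Analysis.Analysis"
begin

text \<open>
  The circle \<open>\<real>/\<int>\<close> is represented by \<open>[0,1)\<close>; its topology is the quotient one,
  induced by the distance of \<open>x - y\<close> to the nearest integer (so points near \<open>0\<close>
  and points near \<open>1\<close> are close to each other).
\<close>

definition circle_dist :: "real \<Rightarrow> real \<Rightarrow> real" where
  "circle_dist x y = infdist (x - y) \<int>"

definition torus :: "(real ^ 'd) set" where
  "torus = {x. \<forall>i. x $ i \<in> {0..<1}}"

text \<open>
  An \<open>N\<close>-point configuration is the tuple \<open>X 0, \<dots>, X (N - 1)\<close>; points may coincide,
  and the values \<open>X k\<close> for \<open>k \<ge> N\<close> are irrelevant.
\<close>

definition configuration :: "nat \<Rightarrow> (nat \<Rightarrow> real ^ 'd) \<Rightarrow> bool" where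
  "configuration N X \<longleftrightarrow> (\<forall>k<N. X k \<in> torus)"

definition tensor_potential :: "(real \<Rightarrow> real) \<Rightarrow> real ^ 'd \<Rightarrow> real" where
  "tensor_potential f t = (\<Prod>i\<in>UNIV. f (t $ i))"

text \<open>
  The differences are those of the representatives in \<open>[0,1)\<close>, hence lie in \<open>(-1,1)\<close>;
  for potentials that are \<open>1\<close>-periodic in each coordinate this is the difference on the torus.
\<close>

definition energy :: "(real ^ 'd \<Rightarrow> real) \<Rightarrow> nat \<Rightarrow> (nat \<Rightarrow> real ^ 'd) \<Rightarrow> real" where
  "energy F N X = (\<Sum>k<N. \<Sum>l\<in>{..<N} - {k}. F (X k - X l))"

definition global_minimizer :: "(real ^ 'd \<Rightarrow> real) \<Rightarrow> nat \<Rightarrow> (nat \<Rightarrow> real ^ 'd) \<Rightarrow> bool" where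
  "global_minimizer F N X \<longleftrightarrow> configuration N X \<and>
     (\<forall>Y. configuration N Y \<longrightarrow> energy F N X \<le> energy F N Y)"

text \<open>
  The product topology on tuples of torus points is that of the maximum of the
  coordinatewise circle distances.
\<close>

definition local_minimizer :: "(real ^ 'd \<Rightarrow> real) \<Rightarrow> nat \<Rightarrow> (nat \<Rightarrow> real ^ 'd) \<Rightarrow> bool" where
  "local_minimizer F N X \<longleftrightarrow> configuration N X \<and>
     (\<exists>\<delta>>0. \<forall>Y. configuration N Y \<longrightarrow>
        (\<forall>k<N. \<forall>i. circle_dist (X k $ i) (Y k $ i) < \<delta>) \<longrightarrow>
        energy F N X \<le> energy F N Y)"

end

(* Move a single point x^k by s and by -s in the coordinate i and compare. A pair of points
   contributes a positive multiple of f (t + s) + f (t - s) - 2 f t to the symmetric second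
   difference of the energy, where t is the i-th coordinate of its difference. This is o(s) if t is
   not an integer, since f is differentiable there, and at most -2 C s if t = 0, by the cusp of f
   at 0. If x^k shares its i-th coordinate with another point, one of the two displacements therefore
   lowers the energy. *)

theory Submission
  imports Defs
begin

lemma periodic_add_of_int:
  fixes f :: "real \<Rightarrow> 'a"
  assumes "\<And>t. f (t + 1) = f t"
  shows "f (t + of_int n) = f t"
proof (induction n arbitrary: t rule: int_induct[where k = 0])
  case (step1 n)
  then show ?case using assms[of "t + of_int n"] by (simp add: add.assoc)
next
  case (step2 n)
  then show ?case using assms[of "t + of_int n - 1"] by (simp add: algebra_simps)
qed simp

text \<open>The expression is the difference of the two difference quotients with increments
  \<open>s\<close> and \<open>- s\<close>; both tend to \<open>D\<close>, so the first-order terms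
  cancel.\<close>

lemma DERIV_symmetric_second_difference:
  fixes f :: "real \<Rightarrow> real"
  assumes "(f has_real_derivative D) (at t)"
  shows "((\<lambda>s. (f (t + s) + f (t - s) - 2 * f t) / s) \<longlongrightarrow> 0) (at_right 0)"
proof -
  have lim: "((\<lambda>h. (f (t + h) - f t) / h) \<longlongrightarrow> D) (at 0)"
    using assms by (simp add: DERIV_def)
  have right: "((\<lambda>h. (f (t + h) - f t) / h) \<longlongrightarrow> D) (at_right 0)"
    using lim by (rule filterlim_mono) (auto simp: at_le)
  have neg: "filterlim uminus (at 0) (at_right (0::real))"
    by (auto simp: filterlim_at eventually_at_filter intro!: tendsto_eq_intros)
  have "((\<lambda>s. (f (t + s) - f t) / s - (f (t + - s) - f t) / - s) \<longlongrightarrow> D - D) (at_right 0)"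
    by (intro tendsto_diff right filterlim_compose[OF lim neg])
  then show ?thesis
    by (simp add: diff_divide_distrib add_divide_distrib algebra_simps)
qed

lemma tensor_potential_remove:
  "tensor_potential f v = (\<Prod>j\<in>UNIV - {i}. f (v $ j)) * f (v $ i)"
  by (simp add: tensor_potential_def prod.remove[of UNIV i] mult.commute)

lemma global_imp_local_minimizer: "global_minimizer F N X \<Longrightarrow> local_minimizer F N X"
  by (auto simp: global_minimizer_def local_minimizer_def intro!: exI[of _ 1])

text \<open>\<open>frac\<close> takes the moved coordinate back to its representative in
  \<open>[0,1)\<close>, so that the result is again a configuration.\<close>

definition displace ::
  "nat \<Rightarrow> 'd \<Rightarrow> real \<Rightarrow> (nat \<Rightarrow> real ^ 'd) \<Rightarrow> nat \<Rightarrow> real ^ 'd" where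
  "displace k i s X = X(k := \<chi> j. if j = i then frac (X k $ i + s) else X k $ j)"

lemma configuration_displace:
  "configuration N X \<Longrightarrow> configuration N (displace k i s X)"
  by (auto simp: configuration_def torus_def displace_def frac_lt_1)

text \<open>The jump of \<open>frac\<close> at the integers is invisible on the circle: the moved
  coordinate differs from the old one by \<open>s\<close> up to an integer.\<close>

lemma circle_dist_displace: "circle_dist (X m $ j) (displace k i s X m $ j) \<le> \<bar>s\<bar>"
proof (cases "m = k \<and> j = i")
  case True
  then have "X m $ j - displace k i s X m $ j = of_int \<lfloor>X k $ i + s\<rfloor> - s"
    by (simp add: displace_def frac_def)
  then have "circle_dist (X m $ j) (displace k i s X m $ j)
      \<le> dist (of_int \<lfloor>X k $ i + s\<rfloor> - s) (of_int \<lfloor>X k $ i + s\<rfloor>)"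
    unfolding circle_dist_def by (metis Ints_of_int infdist_le)
  then show ?thesis by (simp add: dist_real_def)
next
  case False
  then have "X m $ j - displace k i s X m $ j = 0"
    by (auto simp: displace_def)
  then show ?thesis by (simp add: circle_dist_def)
qed

text \<open>Reduction by \<open>frac\<close> changes the difference by an integer, which periodicity
  absorbs. As \<open>a\<close> and \<open>b\<close> are distinct, the coefficient of
  \<open>s\<close> is 1, -1 or 0, according to whether the first point, the second or neither is
  moved.\<close>

lemma tensor_potential_displace:
  assumes periodic: "\<And>t. f (t + 1) = f t" and "a \<noteq> b"
  shows "tensor_potential f (displace k i s X a - displace k i s X b) =
    (\<Prod>j\<in>UNIV - {i}. f ((X a - X b) $ j)) *
    f ((X a - X b) $ i + (of_bool (a = k) - of_bool (b = k)) * s)"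
proof -
  have "\<exists>n::int. (displace k i s X a - displace k i s X b) $ i =
      (X a - X b) $ i + (of_bool (a = k) - of_bool (b = k)) * s + of_int n"
    using \<open>a \<noteq> b\<close>
    by (auto simp: displace_def frac_def
        intro: exI[of _ "- \<lfloor>X k $ i + s\<rfloor>"] exI[of _ "\<lfloor>X k $ i + s\<rfloor>"] exI[of _ 0])
  then have "f ((displace k i s X a - displace k i s X b) $ i) =
      f ((X a - X b) $ i + (of_bool (a = k) - of_bool (b = k)) * s)"
    using periodic_add_of_int[of f, OF periodic] by metis
  moreover have "(\<Prod>j\<in>UNIV - {i}. f ((displace k i s X a - displace k i s X b) $ j)) =
      (\<Prod>j\<in>UNIV - {i}. f ((X a - X b) $ j))"
    by (intro prod.cong) (auto simp: displace_def)
  ultimately show ?thesis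
    by (simp add: tensor_potential_remove[of _ _ i])
qed

text \<open>Pairs without the index \<open>k\<close> cancel. In the others the increment is
  \<open>s\<close> or \<open>- s\<close>, and the second difference is symmetric in the two; the
  factors of the other coordinates do not depend on \<open>s\<close>.\<close>

lemma energy_displace_second_difference:
  assumes periodic: "\<And>t. f (t + 1) = f t"
  shows "energy (tensor_potential f) N (displace k i s X)
      + energy (tensor_potential f) N (displace k i (- s) X)
      - 2 * energy (tensor_potential f) N X =
    (\<Sum>a<N. \<Sum>b\<in>{..<N} - {a}.
      of_bool (a = k \<or> b = k) * (\<Prod>j\<in>UNIV - {i}. f ((X a - X b) $ j)) *
      (f ((X a - X b) $ i + s) + f ((X a - X b) $ i - s) - 2 * f ((X a - X b) $ i)))"
proof -
  have "tensor_potential f (displace k i s X a - displace k i s X b)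
      + tensor_potential f (displace k i (- s) X a - displace k i (- s) X b)
      - 2 * tensor_potential f (X a - X b) =
      of_bool (a = k \<or> b = k) * (\<Prod>j\<in>UNIV - {i}. f ((X a - X b) $ j)) *
      (f ((X a - X b) $ i + s) + f ((X a - X b) $ i - s) - 2 * f ((X a - X b) $ i))"
    if "a \<noteq> b" for a b
    using that
    by (auto simp: tensor_potential_displace[of f, OF periodic]
        tensor_potential_remove[of f "X a - X b" i] algebra_simps)
  then show ?thesis
    by (simp add: energy_def sum_distrib_left flip: sum.distrib sum_subtractf)
qed

text \<open>Differences of representatives lie in \<open>(-1,1)\<close>; a negative one is carried
  into \<open>(0,1)\<close> by one period.\<close>

lemma periodic_differentiable_off_zero:
  fixes f :: "real \<Rightarrow> real"
  assumes periodic: "\<And>t. f (t + 1) = f t"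
    and diff: "f differentiable_on {0<..<1}"
    and t: "\<bar>t\<bar> < 1" "t \<noteq> 0"
  shows "\<exists>D. (f has_real_derivative D) (at t)"
proof -
  have inner: "\<exists>D. (f has_real_derivative D) (at u)" if "u \<in> {0<..<1}" for u
    using diff that by (simp add: differentiable_on_eq_differentiable_at real_differentiable_def)
  show ?thesis
  proof (cases "t > 0")
    case True
    then show ?thesis using inner[of t] t by auto
  next
    case False
    then obtain D where "(f has_real_derivative D) (at (t + 1))"
      using inner[of "t + 1"] t by auto
    then have "((\<lambda>x. f (x + 1)) has_real_derivative D) (at t)"
      by (simp add: DERIV_shift)
    then show ?thesis by (auto simp: periodic)
  qed
qed

theorem corollary3p2:
  fixes f :: "real \<Rightarrow> real" and N :: nat and X :: "nat \<Rightarrow> real ^ 'd"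
  assumes pos: "\<And>t. f t > 0"
    and cont: "continuous_on UNIV f"
    and periodic: "\<And>t. f (t + 1) = f t"
    and even: "\<And>t. f (- t) = f t"
    and diff: "f differentiable_on {0<..<1}"
    and cusp: "\<exists>C>0. \<exists>\<epsilon>>0. \<forall>t. 0 \<le> t \<and> t < \<epsilon> \<longrightarrow> f t \<le> f 0 - C * t"
    and minimizer: "global_minimizer (tensor_potential f) N X
                    \<or> local_minimizer (tensor_potential f) N X"
  shows "\<forall>i. \<forall>k<N. \<forall>l<N. k \<noteq> l \<longrightarrow> X k $ i \<noteq> X l $ i"
proof (intro allI impI notI)
  fix i k l
  assume kl: "k < N" "l < N" "k \<noteq> l" and coincide: "X k $ i = X l $ i"
  obtain C \<epsilon> where C: "C > 0" and \<epsilon>: "\<epsilon> > 0"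
    and cusp': "\<And>t. 0 \<le> t \<Longrightarrow> t < \<epsilon> \<Longrightarrow> f t \<le> f 0 - C * t"
    using cusp by blast
  have "local_minimizer (tensor_potential f) N X"
    using minimizer global_imp_local_minimizer by blast
  then obtain \<delta> where conf: "configuration N X" and \<delta>: "\<delta> > 0"
    and local_min: "\<And>Y. configuration N Y \<Longrightarrow>
        (\<And>k i. k < N \<Longrightarrow> circle_dist (X k $ i) (Y k $ i) < \<delta>) \<Longrightarrow>
        energy (tensor_potential f) N X \<le> energy (tensor_potential f) N Y"
    unfolding local_minimizer_def by blast
  define w where
    "w a b = of_bool (a = k \<or> b = k) * (\<Prod>j\<in>UNIV - {i}. f ((X a - X b) $ j))" for a b
  define \<Delta> where "\<Delta> t s = f (t + s) + f (t - s) - 2 * f t" for t s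
  \<comment> \<open>At \<open>t = 0\<close> the quotient \<open>\<Delta> t s / s\<close> need not
    converge, so it is replaced by the upper bound that the cusp provides. This makes
    \<open>u t\<close> converge to \<open>L t\<close> for every \<open>t\<close> that
    occurs.\<close>
  define u where "u t s = (if t = 0 then - 2 * C else \<Delta> t s / s)" for t s
  define L where "L t = (if t = 0 then - 2 * C else 0)" for t :: real
  define S where "S s = (\<Sum>a<N. \<Sum>b\<in>{..<N} - {a}. w a b * u ((X a - X b) $ i) s)" for s
  have w_nonneg: "w a b \<ge> 0" for a b
    using pos by (simp add: w_def prod_nonneg less_imp_le)
  have w_pos: "w k l > 0"
    using pos by (auto simp: w_def intro!: prod_pos)
  have lim: "(u ((X a - X b) $ i) \<longlongrightarrow> L ((X a - X b) $ i)) (at_right 0)"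
    if "a < N" "b < N" for a b
  proof (cases "(X a - X b) $ i = 0")
    case True
    then show ?thesis by (simp add: u_def[abs_def] L_def)
  next
    case False
    have "X a $ i \<in> {0..<1}" "X b $ i \<in> {0..<1}"
      using conf that by (auto simp: configuration_def torus_def)
    then have "\<bar>(X a - X b) $ i\<bar> < 1" by auto
    then obtain D where "(f has_real_derivative D) (at ((X a - X b) $ i))"
      using periodic_differentiable_off_zero[of f, OF periodic diff _ False] by blast
    from DERIV_symmetric_second_difference[OF this] False show ?thesis
      by (simp add: u_def[abs_def] L_def \<Delta>_def)
  qed
  have "(S \<longlongrightarrow> (\<Sum>a<N. \<Sum>b\<in>{..<N} - {a}. w a b * L ((X a - X b) $ i))) (at_right 0)"
    unfolding S_def by (intro tendsto_sum tendsto_mult tendsto_const lim) auto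
  \<comment> \<open>No term is positive, and the pair \<open>(k, l)\<close> contributes
    \<open>- 2 * C * w k l\<close>, which is negative because \<open>f\<close> is positive.
    Strictness passes first to the row \<open>a = k\<close>, then to the whole sum.\<close>
  moreover have "(\<Sum>a<N. \<Sum>b\<in>{..<N} - {a}. w a b * L ((X a - X b) $ i)) < 0"
  proof -
    have nonpos: "w a b * L t \<le> 0" for a b t
      using C w_nonneg by (simp add: L_def mult_nonneg_nonpos)
    have "w k l * L ((X k - X l) $ i) < 0"
      using w_pos C coincide by (simp add: L_def)
    then have "(\<Sum>b\<in>{..<N} - {k}. w k b * L ((X k - X b) $ i)) < (\<Sum>b\<in>{..<N} - {k}. 0)"
      using kl by (intro sum_strict_mono_ex1 ballI nonpos bexI[of _ l]) auto
    then have "(\<Sum>a<N. \<Sum>b\<in>{..<N} - {a}. w a b * L ((X a - X b) $ i)) < (\<Sum>a<N. 0)"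
      using kl by (intro sum_strict_mono_ex1 ballI sum_nonpos nonpos bexI[of _ k]) auto
    then show ?thesis by simp
  qed
  ultimately have "eventually (\<lambda>s. S s < 0) (at_right 0)"
    by (rule order_tendstoD(2))
  \<comment> \<open>The bound \<open>\<delta>\<close> keeps both displaced configurations in the
    neighbourhood of minimality; \<open>\<epsilon>\<close> makes the cusp estimate available at
    \<open>s\<close>.\<close>
  moreover have "eventually (\<lambda>s. s \<in> {0<..<min \<delta> \<epsilon>}) (at_right 0)"
    using \<delta> \<epsilon> by (intro eventually_at_right_real) simp
  ultimately have "eventually (\<lambda>s. S s < 0 \<and> s \<in> {0<..<min \<delta> \<epsilon>}) (at_right 0)"
    by (rule eventually_conj)
  then obtain s where s: "S s < 0" "0 < s" "s < \<delta>" "s < \<epsilon>"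
    using eventually_happens[of _ "at_right (0::real)"] by auto
  \<comment> \<open>For nonzero \<open>t\<close> this is an equality. At 0, evenness turns the
    second difference into \<open>2 * (f s - f 0)\<close>, which the cusp bounds by
    \<open>- 2 * C * s\<close>.\<close>
  have \<Delta>_le: "\<Delta> t s \<le> s * u t s" for t
    using cusp'[of s] even[of s] s
    by (cases "t = 0") (simp_all add: \<Delta>_def u_def, simp add: algebra_simps)
  have "energy (tensor_potential f) N (displace k i s X)
      + energy (tensor_potential f) N (displace k i (- s) X)
      - 2 * energy (tensor_potential f) N X =
      (\<Sum>a<N. \<Sum>b\<in>{..<N} - {a}. w a b * \<Delta> ((X a - X b) $ i) s)"
    unfolding w_def \<Delta>_def by (rule energy_displace_second_difference[of f, OF periodic])
  also have "\<dots> \<le> (\<Sum>a<N. \<Sum>b\<in>{..<N} - {a}. w a b * (s * u ((X a - X b) $ i) s))"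
    by (intro sum_mono mult_left_mono \<Delta>_le w_nonneg)
  also have "\<dots> = s * S s"
    by (simp add: S_def sum_distrib_left mult.left_commute)
  also have "\<dots> < 0"
    using s by (simp add: mult_pos_neg)
  finally have "energy (tensor_potential f) N (displace k i s X)
      + energy (tensor_potential f) N (displace k i (- s) X)
      < 2 * energy (tensor_potential f) N X" by simp
  moreover have "energy (tensor_potential f) N X \<le> energy (tensor_potential f) N (displace k i r X)"
    if "\<bar>r\<bar> < \<delta>" for r
    using that
    by (intro local_min configuration_displace conf le_less_trans[OF circle_dist_displace])
  from this[of s] this[of "- s"]
  have "2 * energy (tensor_potential f) N X \<le> energy (tensor_potential f) N (displace k i s X)
      + energy (tensor_potential f) N (displace k i (- s) X)"
    using s by simp
  ultimately show False by simp
qed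

end
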